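(* Let $f:\mathbb{R}^n\to\mathbb{R}$ be convex and $\beta$-smooth, $\beta>0$, with a minimizer $x^*$. Let $x_1\in\mathbb{R}^n$ and let gradient descent with $\eta=\frac1\beta$ be defined by $x_{s+1}=x_s-\eta\nabla f(x_s)$, $s\ge 1$. Then for every $t\ge 2$, $$f(x_t)-f(x^* )\le\frac{2\beta\|x_1-x^*\|^2}{t-1}.$$
   Context: $\|\cdot\|$ is the Euclidean norm. A continuously differentiable function $f$ is $\beta$-smooth if $\|\nabla f(x)-\nabla f(y)\|\le\beta\|x-y\|$ for all $x,y$. $x^*$ denotes a minimizer of $f$ over $\mathbb{R}^n$, assumed to exist. *)

theory Defs
  imports "HOL-Analysis.Analysis"
begin

text \<open>The gradient is unique where it exists; at points where \<open>f\<close> is not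
  differentiable, \<open>gradient f x\<close> is an unspecified vector.\<close>

definition gradient :: "('a::euclidean_space \<Rightarrow> real) \<Rightarrow> 'a \<Rightarrow> 'a" where
  "gradient f x = (THE D. GDERIV f x :> D)"

definition continuously_differentiable :: "('a::euclidean_space \<Rightarrow> real) \<Rightarrow> bool" where
  "continuously_differentiable f \<longleftrightarrow>
     (\<forall>x. f differentiable (at x)) \<and> continuous_on UNIV (gradient f)"

definition smooth :: "real \<Rightarrow> ('a::euclidean_space \<Rightarrow> real) \<Rightarrow> bool" where
  "smooth \<beta> f \<longleftrightarrow>
     continuously_differentiable f \<and>
     (\<forall>x y. norm (gradient f x - gradient f y) \<le> \<beta> * norm (x - y))"

end

theory Submission
  imports Defs
begin

text \<open>
  Write \<open>g\<^sub>s\<close> for the gradient at \<open>x\<^sub>s\<close> and \<open>\<delta>\<^sub>s = f(x\<^sub>s) - f(x\<^sup>*)\<close>. Two inequalities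
  carry the proof: a convex function lies above its tangents
  (\<open>convex_above_tangent\<close>), and a \<open>\<beta>\<close>-smooth one lies below the parabola of curvature
  \<open>\<beta>\<close> on each tangent (\<open>smooth_quadratic_upper_bound\<close>). The step size
  \<open>1/\<beta>\<close> goes to the minimum of that parabola, so that
  \<open>f(x\<^bsub>s+1\<^esub>) \<le> f(x\<^sub>s) - \<parallel>g\<^sub>s\<parallel>\<^sup>2 / (2\<beta>)\<close>. The tangent at \<open>x\<^sub>s\<close>, evaluated at
  \<open>x\<^sup>*\<close>, bounds \<open>\<delta>\<^sub>s\<close> by \<open>\<langle>x\<^sub>s - x\<^sup>*, g\<^sub>s\<rangle>\<close>; substituting this and completing the
  square gives
  \<open>\<delta>\<^bsub>s+1\<^esub> \<le> \<beta>/2 (\<parallel>x\<^sub>s - x\<^sup>*\<parallel>\<^sup>2 - \<parallel>x\<^bsub>s+1\<^esub> - x\<^sup>*\<parallel>\<^sup>2)\<close>.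
  The right-hand side telescopes. Together with \<open>\<delta>\<^bsub>s+1\<^esub> \<le> \<delta>\<^sub>s\<close> it makes the potential
  \<open>(s - 1) \<delta>\<^sub>s + \<beta>/2 \<parallel>x\<^sub>s - x\<^sup>*\<parallel>\<^sup>2\<close> nonincreasing in \<open>s\<close>, and comparing
  \<open>s = t\<close> with \<open>s = 1\<close> yields \<open>(t - 1) \<delta>\<^sub>t \<le> \<beta>/2 \<parallel>x\<^sub>1 - x\<^sup>*\<parallel>\<^sup>2\<close>, which is
  a quarter of the claimed bound.
\<close>

lemma GDERIV_gradient:
  fixes f :: "'a::euclidean_space \<Rightarrow> real"
  assumes "f differentiable (at x)"
  shows "GDERIV f x :> gradient f x"
proof -
  obtain f' where f': "(f has_derivative f') (at x)"
    using assms by (auto simp: differentiable_def)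
  \<comment> \<open>The adjoint supplies the vector that represents the linear functional \<open>f'\<close>.\<close>
  have "f' = (\<lambda>h. inner h (adjoint f' 1))"
    using adjoint_works[OF has_derivative_linear[OF f'], of _ 1] by (auto simp: fun_eq_iff)
  with f' have ex: "GDERIV f x :> adjoint f' 1"
    by (simp add: gderiv_def)
  have unique: "D = E" if "GDERIV f x :> D" "GDERIV f x :> E" for D E
  proof -
    have "(\<lambda>h. inner h D) = (\<lambda>h. inner h E)"
      using that unfolding gderiv_def by (rule has_derivative_unique)
    then show ?thesis
      by (metis vector_eq_ldot)
  qed
  show ?thesis
    unfolding gradient_def by (rule theI[of _ "adjoint f' 1"]) (use ex unique in auto)
qed

lemma DERIV_along_line:
  fixes f :: "'a::euclidean_space \<Rightarrow> real"
  assumes "\<And>z. f differentiable (at z)"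
  shows "((\<lambda>u. f (a + u *\<^sub>R d)) has_real_derivative inner d (gradient f (a + u *\<^sub>R d)))
           (at u within S)"
proof -
  have line: "((\<lambda>u. a + u *\<^sub>R d) has_derivative (\<lambda>h. h *\<^sub>R d)) (at u within S)"
    by (auto intro!: derivative_eq_intros)
  have "(f has_derivative (\<lambda>h. inner h (gradient f (a + u *\<^sub>R d)))) (at (a + u *\<^sub>R d))"
    using GDERIV_gradient[OF assms] by (simp add: gderiv_def)
  from has_derivative_compose[OF line this] show ?thesis
    by (simp add: has_field_derivative_def mult_commute_abs)
qed

text \<open>The restriction of \<open>f\<close> to the line through \<open>a\<close> and \<open>b\<close> is again convex, which
  reduces the claim to the tangent inequality for functions of one real variable.\<close>

lemma convex_above_tangent:
  fixes f :: "'a::euclidean_space \<Rightarrow> real"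
  assumes convex: "convex_on UNIV f"
    and diff: "\<And>z. f differentiable (at z)"
  shows "f a + inner (b - a) (gradient f a) \<le> f b"
proof -
  let ?\<phi> = "\<lambda>u::real. f (a + u *\<^sub>R (b - a))"
  have "convex_on UNIV ?\<phi>"
  proof (rule convex_onI)
    fix t u v :: real
    assume t: "0 < t" "t < 1"
    have "a + ((1 - t) *\<^sub>R u + t *\<^sub>R v) *\<^sub>R (b - a) =
        (1 - t) *\<^sub>R (a + u *\<^sub>R (b - a)) + t *\<^sub>R (a + v *\<^sub>R (b - a))"
      by (simp add: algebra_simps)
    then show "?\<phi> ((1 - t) *\<^sub>R u + t *\<^sub>R v) \<le> (1 - t) * ?\<phi> u + t * ?\<phi> v"
      using convex_onD[OF convex, of t] t by simp
  qed simp
  from convex_on_imp_above_tangent[OF this _ _ _ DERIV_along_line[OF diff], of 0 1]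
  show ?thesis
    by simp
qed

text \<open>At \<open>a + u (b - a)\<close>, the derivative of \<open>f\<close> in direction \<open>b - a\<close> exceeds its value at \<open>a\<close> by at most
  \<open>\<beta> u \<parallel>b - a\<parallel>\<^sup>2\<close>, by Cauchy--Schwarz and the Lipschitz condition; the factor
  \<open>1/2\<close> comes from the antiderivative of \<open>u\<close>.\<close>

lemma smooth_quadratic_upper_bound:
  fixes f :: "'a::euclidean_space \<Rightarrow> real"
  assumes diff: "\<And>z. f differentiable (at z)"
    and lipschitz: "\<And>y z. norm (gradient f y - gradient f z) \<le> \<beta> * norm (y - z)"
  shows "f b \<le> f a + inner (b - a) (gradient f a) + \<beta> / 2 * (norm (b - a))\<^sup>2"
proof -
  define d where "d = b - a"
  let ?\<psi> = "\<lambda>u. f (a + u *\<^sub>R d) - u * inner d (gradient f a) - \<beta> / 2 * u\<^sup>2 * (norm d)\<^sup>2"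
  have "?\<psi> 1 \<le> ?\<psi> 0"
  proof (rule DERIV_nonpos_imp_nonincreasing[where f = ?\<psi>])
    fix u :: real
    assume u: "0 \<le> u" "u \<le> 1"
    let ?D = "inner d (gradient f (a + u *\<^sub>R d)) - inner d (gradient f a) - \<beta> * u * (norm d)\<^sup>2"
    have "(?\<psi> has_real_derivative ?D) (at u)"
      by (auto intro!: derivative_eq_intros DERIV_along_line[OF diff])
    moreover have "inner d (gradient f (a + u *\<^sub>R d) - gradient f a) \<le> norm d * (\<beta> * (u * norm d))"
      using norm_cauchy_schwarz[of d "gradient f (a + u *\<^sub>R d) - gradient f a"]
        mult_left_mono[OF lipschitz[of "a + u *\<^sub>R d" a], of "norm d"] u
      by simp
    then have "?D \<le> 0"
      by (simp add: inner_diff_right power2_eq_square mult_ac)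
    ultimately show "\<exists>y. (?\<psi> has_real_derivative y) (at u) \<and> y \<le> 0"
      by blast
  qed simp
  then show ?thesis
    by (simp add: d_def)
qed

lemma gradient_step_decrease:
  fixes f :: "'a::euclidean_space \<Rightarrow> real"
  assumes "\<beta> > 0"
    and "\<And>z. f differentiable (at z)"
    and "\<And>y z. norm (gradient f y - gradient f z) \<le> \<beta> * norm (y - z)"
  shows "f (a - (1 / \<beta>) *\<^sub>R gradient f a) \<le> f a - (norm (gradient f a))\<^sup>2 / (2 * \<beta>)"
proof -
  let ?g = "gradient f a"
  have "f (a - (1 / \<beta>) *\<^sub>R ?g) \<le> f a + inner (- (1 / \<beta>) *\<^sub>R ?g) ?g
      + \<beta> / 2 * (norm ((1 / \<beta>) *\<^sub>R ?g))\<^sup>2"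
    using smooth_quadratic_upper_bound[OF assms(2,3), of "a - (1 / \<beta>) *\<^sub>R ?g" a] by simp
  also have "\<dots> = f a - (norm ?g)\<^sup>2 / (2 * \<beta>)"
    using \<open>\<beta> > 0\<close> by (simp add: dot_square_norm power_divide field_simps power2_eq_square)
  finally show ?thesis .
qed

text \<open>Expanding the square of
  \<open>(a - c) - g/\<beta>\<close>, where \<open>g\<close> is the gradient at \<open>a\<close>, shows that the right-hand side
  equals \<open>\<langle>a - c, g\<rangle> - \<parallel>g\<parallel>\<^sup>2 / (2\<beta>)\<close>: the bound on \<open>f a - f c\<close> given by
  convexity, minus the decrease guaranteed by smoothness.\<close>

lemma gradient_step_progress:
  fixes f :: "'a::euclidean_space \<Rightarrow> real"
  assumes "\<beta> > 0" and "convex_on UNIV f"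
    and diff: "\<And>z. f differentiable (at z)"
    and lipschitz: "\<And>y z. norm (gradient f y - gradient f z) \<le> \<beta> * norm (y - z)"
  shows "f (a - (1 / \<beta>) *\<^sub>R gradient f a) - f c
    \<le> \<beta> / 2 * ((norm (a - c))\<^sup>2 - (norm (a - (1 / \<beta>) *\<^sub>R gradient f a - c))\<^sup>2)"
proof -
  let ?g = "gradient f a"
  have "f (a - (1 / \<beta>) *\<^sub>R ?g) - f c \<le> inner (a - c) ?g - (norm ?g)\<^sup>2 / (2 * \<beta>)"
    using gradient_step_decrease[OF \<open>\<beta> > 0\<close> diff lipschitz, of a]
      convex_above_tangent[OF \<open>convex_on UNIV f\<close> diff, of a c]
    by (simp add: inner_diff_left)
  also have "\<dots> = \<beta> / 2 * ((norm (a - c))\<^sup>2 - (norm ((a - c) - (1 / \<beta>) *\<^sub>R ?g))\<^sup>2)"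
  proof -
    have "(norm ((a - c) - (1 / \<beta>) *\<^sub>R ?g))\<^sup>2
        = (norm (a - c))\<^sup>2 - 2 / \<beta> * inner (a - c) ?g + (norm ?g)\<^sup>2 / \<beta>\<^sup>2"
      using dot_norm_neg[of "a - c" "(1 / \<beta>) *\<^sub>R ?g"] \<open>\<beta> > 0\<close>
      by (simp add: power_divide field_simps)
    then show ?thesis
      using \<open>\<beta> > 0\<close> by (simp add: field_simps power2_eq_square)
  qed
  finally show ?thesis
    by (simp add: algebra_simps)
qed

theorem theorem3p3:
  fixes f :: "real ^ 'n \<Rightarrow> real"
    and \<beta> \<eta> :: real
    and xstar :: "real ^ 'n"
    and x :: "nat \<Rightarrow> real ^ 'n"
    and t :: nat
  assumes "convex_on UNIV f"
    and "\<beta> > 0"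
    and "smooth \<beta> f"
    and "\<forall>y. f xstar \<le> f y"
    and "\<eta> = 1 / \<beta>"
    and "\<forall>s\<ge>1. x (s + 1) = x s - \<eta> *\<^sub>R gradient f (x s)"
    and "t \<ge> 2"
  shows "f (x t) - f xstar \<le> 2 * \<beta> * (norm (x 1 - xstar))\<^sup>2 / (real t - 1)"
proof -
  have diff: "\<And>z. f differentiable (at z)"
    and lipschitz: "\<And>y z. norm (gradient f y - gradient f z) \<le> \<beta> * norm (y - z)"
    using \<open>smooth \<beta> f\<close> by (auto simp: smooth_def continuously_differentiable_def)
  let ?\<delta> = "\<lambda>s. f (x s) - f xstar"
  let ?r = "\<lambda>s. \<beta> / 2 * (norm (x s - xstar))\<^sup>2"
  have potential: "real n * ?\<delta> (Suc n) + ?r (Suc n) \<le> ?r 1" for n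
  proof (induction n)
    case 0
    then show ?case by simp
  next
    case (Suc n)
    have step: "x (Suc (Suc n)) = x (Suc n) - (1 / \<beta>) *\<^sub>R gradient f (x (Suc n))"
      using assms(5,6) by (metis Suc_eq_plus1 le_add2)
    have "?\<delta> (Suc (Suc n)) \<le> ?\<delta> (Suc n) - (norm (gradient f (x (Suc n))))\<^sup>2 / (2 * \<beta>)"
      using gradient_step_decrease[OF \<open>\<beta> > 0\<close> diff lipschitz, of "x (Suc n)"]
      by (simp add: step)
    also have "\<dots> \<le> ?\<delta> (Suc n)"
      using \<open>\<beta> > 0\<close> by simp
    finally have "real n * ?\<delta> (Suc (Suc n)) \<le> real n * ?\<delta> (Suc n)"
      by (rule mult_left_mono) simp
    moreover have "?\<delta> (Suc (Suc n)) \<le> ?r (Suc n) - ?r (Suc (Suc n))"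
      using gradient_step_progress[OF \<open>\<beta> > 0\<close> \<open>convex_on UNIV f\<close> diff lipschitz,
          of "x (Suc n)" xstar]
      by (simp add: step right_diff_distrib)
    moreover have "real (Suc n) * ?\<delta> (Suc (Suc n))
        = real n * ?\<delta> (Suc (Suc n)) + ?\<delta> (Suc (Suc n))"
      by (simp add: algebra_simps)
    ultimately show ?case
      using Suc.IH by linarith
  qed
  have "(real t - 1) * ?\<delta> t + ?r t \<le> ?r 1"
    using potential[of "t - 1"] \<open>t \<ge> 2\<close> by (simp add: of_nat_diff)
  moreover have "0 \<le> ?r t" and "?r 1 \<le> 2 * \<beta> * (norm (x 1 - xstar))\<^sup>2"
    using \<open>\<beta> > 0\<close> by (auto intro: mult_right_mono)
  ultimately have "?\<delta> t * (real t - 1) \<le> 2 * \<beta> * (norm (x 1 - xstar))\<^sup>2"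
    by (simp only: mult.commute[of "?\<delta> t"])
  then show ?thesis
    using \<open>t \<ge> 2\<close> by (simp add: pos_le_divide_eq)
qed

end
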